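(* Let $\preceq$ be an artinian preorder on a monoid $H$ and let $s$ be an integer $\ge 2$. Then every $\preceq$-non-unit $x \in H$ factors as a non-empty, finite product of $s^{\mathrm{ht}(x)-1}$ or fewer $\preceq$-irreducibles of degree $s$ of $H$, where $\mathrm{ht}(x)$ is the $\preceq$-height of $x$ (if $\mathrm{ht}(x)=\infty$, the bound is understood to be $\infty$, that is, no constraint on the finite number of factors).
   Context: A monoid is a semigroup with identity $1_H$ (not necessarily commutative or cancellative). A preorder $\preceq$ on $H$ is a reflexive and transitive relation on the set $H$ (no compatibility with multiplication is assumed). Write $x \prec y$ if $x \preceq y$ and $y \not\preceq x$. The preorder is artinian if there is no infinite sequence $(x_k)_{k\ge 0}$ in $H$ with $x_{k+1} \prec x_k$ for all $k$. An element $u \in H$ is a $\preceq$-unit if $u \preceq 1_H \preceq u$, and a $\preceq$-non-unit otherwise. For an integer $s \ge 2$, a $\preceq$-irreducible of degree $s$ is a $\preceq$-non-unit $a \in H$ such that for every integer $k$ with $2 \le k \le s$ there are no $\preceq$-non-units $b_1, \ldots, b_k \in H$ with $b_i \prec a$ for all $i$ and $a = b_1 \cdots b_k$. The $\preceq$-height $\mathrm{ht}(x) \in \mathbb{N} \cup \{\infty\}$ of $x \in H$ is the supremum of the set of all integers $n \ge 1$ for which there are $\preceq$-non-units $x_1, \ldots, x_n \in H$ with $x_1 = x$ and $x_{k+1} \prec x_k$ for $1 \le k \le n-1$, with $\sup\emptyset := 0$. *)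

theory Defs
  imports Main "HOL-Library.Extended_Nat"
begin

definition preorder_strict :: "('a \<Rightarrow> 'a \<Rightarrow> bool) \<Rightarrow> 'a \<Rightarrow> 'a \<Rightarrow> bool" where
  "preorder_strict le x y \<longleftrightarrow> le x y \<and> \<not> le y x"

definition is_preorder :: "('a \<Rightarrow> 'a \<Rightarrow> bool) \<Rightarrow> bool" where
  "is_preorder le \<longleftrightarrow> reflp le \<and> transp le"

definition artinian :: "('a \<Rightarrow> 'a \<Rightarrow> bool) \<Rightarrow> bool" where
  "artinian le \<longleftrightarrow> \<not> (\<exists>x :: nat \<Rightarrow> 'a. \<forall>k. preorder_strict le (x (Suc k)) (x k))"

definition preorder_unit :: "('a::monoid_mult \<Rightarrow> 'a \<Rightarrow> bool) \<Rightarrow> 'a \<Rightarrow> bool" where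
  "preorder_unit le u \<longleftrightarrow> le u 1 \<and> le 1 u"

definition preorder_irreducible :: "('a::monoid_mult \<Rightarrow> 'a \<Rightarrow> bool) \<Rightarrow> nat \<Rightarrow> 'a \<Rightarrow> bool" where
  "preorder_irreducible le s a \<longleftrightarrow>
     \<not> preorder_unit le a \<and>
     (\<forall>k. 2 \<le> k \<and> k \<le> s \<longrightarrow>
        \<not> (\<exists>bs. length bs = k \<and>
               (\<forall>b \<in> set bs. \<not> preorder_unit le b \<and> preorder_strict le b a) \<and>
               a = prod_list bs))"

text \<open>
  The supremum is taken in \<^typ>\<open>enat\<close>, where the supremum of the empty set is \<open>0\<close> and that of
  an unbounded set is \<open>\<infinity>\<close>. The chain \<open>y\<close> is a total function of which only the values at
  \<open>1, \<dots>, n\<close> matter.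
\<close>

definition preorder_height :: "('a::monoid_mult \<Rightarrow> 'a \<Rightarrow> bool) \<Rightarrow> 'a \<Rightarrow> enat" where
  "preorder_height le x =
     Sup {enat n | n. 1 \<le> n \<and>
       (\<exists>y :: nat \<Rightarrow> 'a. y 1 = x \<and>
          (\<forall>k \<in> {1..n}. \<not> preorder_unit le (y k)) \<and>
          (\<forall>k. 1 \<le> k \<and> k < n \<longrightarrow> preorder_strict le (y (k + 1)) (y k)))}"

end

theory Submission
  imports Defs
begin

text \<open>
  Well-founded induction on the strict part of the preorder. A non-unit that is not irreducible of
  degree \<open>s\<close> is a product of at most \<open>s\<close> strictly smaller non-units. Prolonging a descending chain
  at its top shows that the height of each of these drops by at least one, so concatenating
  their factorizations costs a factor of at most \<open>s\<close> in the length.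
\<close>

lemma artinian_imp_wfp:
  assumes "artinian le"
  shows "wfp (preorder_strict le)"
  using assms
  by (simp add: artinian_def wfp_def wf_iff_no_infinite_down_chain)

text \<open>The element alone is a chain of length 1. This keeps the height of a non-unit away from
  the default value 0 of the empty supremum.\<close>

lemma preorder_height_ge_1:
  assumes "\<not> preorder_unit le x"
  shows "1 \<le> preorder_height le x"
  unfolding preorder_height_def one_enat_def
  using assms by (intro Sup_upper CollectI exI[of _ 1] exI[of _ "\<lambda>_. x"] conjI) auto

text \<open>Putting \<open>x\<close> above a chain of length \<open>n\<close> from \<open>b\<close>
  gives a chain of length \<open>Suc n\<close> from \<open>x\<close>. The form with
  \<open>eSuc\<close> also covers infinite heights, where subtracting 1 would say nothing.\<close>

lemma eSuc_preorder_height_le: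
  assumes "\<not> preorder_unit le b" "\<not> preorder_unit le x" "preorder_strict le b x"
  shows "eSuc (preorder_height le b) \<le> preorder_height le x"
proof -
  define A where "A = (\<lambda>x. {enat n | n. 1 \<le> n \<and>
       (\<exists>y :: nat \<Rightarrow> 'a. y 1 = x \<and>
          (\<forall>k \<in> {1..n}. \<not> preorder_unit le (y k)) \<and>
          (\<forall>k. 1 \<le> k \<and> k < n \<longrightarrow> preorder_strict le (y (k + 1)) (y k)))})"
  have height: "preorder_height le z = Sup (A z)" for z
    by (simp add: preorder_height_def A_def)
  \<comment> \<open>\<open>eSuc\<close> commutes only with suprema of non-empty sets:
    \<open>Sup {}\<close> is 0, but \<open>eSuc 0\<close> is 1.\<close>
  have "A b \<noteq> {}"
    using preorder_height_ge_1[OF assms(1)] unfolding height by (auto simp: bot_enat_def)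
  then have "eSuc (preorder_height le b) = Sup (eSuc ` A b)"
    by (simp add: height eSuc_Sup)
  also have "\<dots> \<le> Sup (A x)"
  proof (rule Sup_subset_mono, safe)
    fix m assume "m \<in> A b"
    then obtain n y where m: "m = enat n" "1 \<le> n" and y: "y 1 = b"
      "\<forall>k \<in> {1..n}. \<not> preorder_unit le (y k)"
      "\<forall>k. 1 \<le> k \<and> k < n \<longrightarrow> preorder_strict le (y (k + 1)) (y k)"
      by (auto simp: A_def)
    \<comment> \<open>Chains are indexed from 1, so \<open>x\<close> takes index 1 and
      \<open>y\<close> is shifted up by one; the value at 0 is irrelevant.\<close>
    define z where "z = (\<lambda>k. if k \<le> 1 then x else y (k - 1))"
    have "\<not> preorder_unit le (z k)" if "k \<in> {1..Suc n}" for k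
      using that y(2) assms(2) by (cases k) (auto simp: z_def)
    moreover have "preorder_strict le (z (k + 1)) (z k)" if "1 \<le> k" "k < Suc n" for k
    proof (cases "k = 1")
      case True
      then show ?thesis using y(1) assms(3) by (simp add: z_def)
    next
      case False
      then show ?thesis using y(3) that by (cases k) (auto simp: z_def)
    qed
    moreover have "z 1 = x" by (simp add: z_def)
    ultimately show "eSuc m \<in> A x"
      unfolding A_def m eSuc_enat
      by (intro CollectI exI[of _ "Suc n"] exI[of _ z] conjI) auto
  qed
  finally show ?thesis by (simp add: height)
qed

lemma length_concat_map_le:
  assumes "\<And>b. b \<in> set bs \<Longrightarrow> length (f b) \<le> m"
  shows "length (concat (map f bs)) \<le> length bs * m"
  using assms by (induction bs) (auto intro: add_mono)

lemma prod_list_concat_map: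
  assumes "\<And>b. b \<in> set bs \<Longrightarrow> prod_list (f b) = (b :: 'a::monoid_mult)"
  shows "prod_list (concat (map f bs)) = prod_list bs"
  using assms by (induction bs) auto

theorem theorem3p4:
  fixes le :: "'a::monoid_mult \<Rightarrow> 'a \<Rightarrow> bool" and s :: nat and x :: 'a
  assumes "is_preorder le" and "artinian le"
    and "s \<ge> 2"
    and "\<not> preorder_unit le x"
  shows "\<exists>as. as \<noteq> [] \<and> (\<forall>a \<in> set as. preorder_irreducible le s a) \<and> x = prod_list as \<and>
           enat (length as) \<le> (case preorder_height le x of enat h \<Rightarrow> enat (s ^ (h - 1)) | \<infinity> \<Rightarrow> \<infinity>)"
  using artinian_imp_wfp[OF assms(2)] assms(4)
proof (induction x rule: wfp_induct_rule)
  case (less x)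
  show ?case
  proof (cases "preorder_irreducible le s x")
    case True
    have "enat (length [x]) \<le>
        (case preorder_height le x of enat h \<Rightarrow> enat (s ^ (h - 1)) | \<infinity> \<Rightarrow> \<infinity>)"
      using assms(3) by (auto split: enat.split)
    with True show ?thesis by (intro exI[of _ "[x]"]) simp
  next
    case False
    \<comment> \<open>Since \<open>x\<close> is a non-unit, irreducibility can only fail through a
      forbidden factorization of some length between 2 and \<open>s\<close>.\<close>
    then obtain bs where bs: "2 \<le> length bs" "length bs \<le> s" "x = prod_list bs"
      and b: "\<And>b. b \<in> set bs \<Longrightarrow> \<not> preorder_unit le b \<and> preorder_strict le b x"
      using less.prems unfolding preorder_irreducible_def by blast
    have "\<forall>b \<in> set bs. \<exists>as. as \<noteq> [] \<and> (\<forall>a \<in> set as. preorder_irreducible le s a) \<and>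
        b = prod_list as \<and>
        enat (length as) \<le> (case preorder_height le b of enat h \<Rightarrow> enat (s ^ (h - 1)) | \<infinity> \<Rightarrow> \<infinity>)"
      using less.IH b by blast
    from bchoice[OF this] obtain f where f: "\<And>b. b \<in> set bs \<Longrightarrow> f b \<noteq> []"
      "\<And>b. b \<in> set bs \<Longrightarrow> \<forall>a \<in> set (f b). preorder_irreducible le s a"
      "\<And>b. b \<in> set bs \<Longrightarrow> b = prod_list (f b)"
      "\<And>b. b \<in> set bs \<Longrightarrow> enat (length (f b)) \<le>
        (case preorder_height le b of enat h \<Rightarrow> enat (s ^ (h - 1)) | \<infinity> \<Rightarrow> \<infinity>)"
      by blast
    let ?as = "concat (map f bs)"
    \<comment> \<open>Only finite heights need an argument, since the bound is \<infinity>
      otherwise.\<close>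
    have bound: "length ?as \<le> s ^ (h - 1)" if h: "preorder_height le x = enat h" for h
    proof -
      \<comment> \<open>The height of \<open>b\<close> lies between 1 and \<open>h - 1\<close>,
        whence \<open>2 \<le> h\<close>. It may drop by more than one, which monotonicity of powers
        of \<open>s\<close> absorbs.\<close>
      have drop: "2 \<le> h \<and> length (f b) \<le> s ^ (h - 2)" if "b \<in> set bs" for b
      proof -
        have "eSuc (preorder_height le b) \<le> enat h" "1 \<le> preorder_height le b"
          using eSuc_preorder_height_le[of le b x] preorder_height_ge_1[of le b]
            b[OF that] less.prems h by simp_all
        then obtain g where g: "preorder_height le b = enat g" "Suc g \<le> h" "1 \<le> g"
          by (cases "preorder_height le b") (auto simp: eSuc_enat one_enat_def)
        then have "length (f b) \<le> s ^ (g - 1)" using f(4)[OF that] by simp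
        also have "\<dots> \<le> s ^ (h - 2)"
          using g assms(3) by (intro power_increasing) auto
        finally show ?thesis using g by simp
      qed
      \<comment> \<open>Any one factor yields \<open>2 \<le> h\<close>. With truncated subtraction,
        \<open>s * s ^ (h - 2) = s ^ (h - 1)\<close> would fail at \<open>h = 1\<close>.\<close>
      obtain b where "b \<in> set bs" using bs(1) by (cases bs) auto
      then have "2 \<le> h" using drop by blast
      have "length ?as \<le> length bs * s ^ (h - 2)"
        using drop by (intro length_concat_map_le) blast
      also have "\<dots> \<le> s * s ^ (h - 2)" using bs(2) by simp
      also have "\<dots> = s ^ (h - 1)"
        using \<open>2 \<le> h\<close> by (auto simp: numeral_2_eq_2 dest!: le_Suc_ex)
      finally show ?thesis .
    qed
    show ?thesis
    proof (intro exI[of _ ?as] conjI)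
      show "?as \<noteq> []" using bs(1) f(1) by (cases bs) auto
      show "\<forall>a \<in> set ?as. preorder_irreducible le s a" using f(2) by auto
      show "x = prod_list ?as" using bs(3) prod_list_concat_map[of bs f] f(3)[symmetric] by simp
      show "enat (length ?as) \<le>
          (case preorder_height le x of enat h \<Rightarrow> enat (s ^ (h - 1)) | \<infinity> \<Rightarrow> \<infinity>)"
        using bound by (auto split: enat.split)
    qed
  qed
qed

end
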